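(* Let $p(x)\in\mathbb{Z}[x]$ and let $r\ge 0$ be an integer. For integers $n$ and $k$ with $n\ge r$ and $k\ge 1$, $$\sum_{j=r}^n\bigl(p([j]_q)\bigr)^k=-\sum_{\ell=1}^{n-r+1}\ell\,\overline{s}_{n+1,n+1-\ell,r}^{p(x)}(q)\,\overline{S}_{n+k-\ell,n,r}^{p(x)}(q).$$
   Context: Here $q$ is an indeterminate and $[m]_q=\frac{q^m-1}{q-1}=1+q+\cdots+q^{m-1}$ for $m\ge 0$. The type I $q,r$-poly-Stirling numbers of the second kind are defined by $\overline{S}_{r,r,r}^{p(x)}(q)=1$, $\overline{S}_{n,k,r}^{p(x)}(q)=0$ for $k<r$, $k>n$ or $n<r$, and $\overline{S}_{n,k,r}^{p(x)}(q)=\overline{S}_{n-1,k-1,r}^{p(x)}(q)+p([k]_q)\,\overline{S}_{n-1,k,r}^{p(x)}(q)$ for $r\le k\le n$, $n>r$. The type I signed $q,r$-poly-Stirling numbers of the first kind are defined by $\overline{s}_{r,r,r}^{p(x)}(q)=1$, $\overline{s}_{n,k,r}^{p(x)}(q)=0$ for $k<r$, $k>n$ or $n<r$, and $\overline{s}_{n,k,r}^{p(x)}(q)=\overline{s}_{n-1,k-1,r}^{p(x)}(q)-p([n-1]_q)\,\overline{s}_{n-1,k,r}^{p(x)}(q)$ for $r\le k\le n$, $n>r$. *)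

theory Defs
  imports "HOL-Computational_Algebra.Polynomial"
begin

text \<open>The indeterminate \<open>q\<close> is the variable of the type \<^typ>\<open>int poly\<close>.\<close>

definition q_bracket :: "nat \<Rightarrow> int poly" where
  "q_bracket m = (\<Sum>i<m. monom 1 i)"

lemma q_bracket_mult: "(monom 1 1 - 1) * q_bracket m = monom 1 m - 1"
  by (induction m)
     (simp_all add: q_bracket_def algebra_simps mult_monom monom_0 one_pCons)

text \<open>The coefficient \<open>p([m]\<^sub>q)\<close> is the composition \<^term>\<open>pcompose p (q_bracket m)\<close>.
  The guard \<open>k = 0\<close> (relevant only for \<open>r = 0\<close>) is there because \<open>k - 1\<close> truncates
  on \<^typ>\<open>nat\<close>: the number with second index \<open>-1 < r\<close> is 0.\<close>

function qr_stirling2 :: "int poly \<Rightarrow> nat \<Rightarrow> nat \<Rightarrow> nat \<Rightarrow> int poly" where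
  "qr_stirling2 p r n k =
    (if n = r \<and> k = r then 1
     else if k < r \<or> k > n \<or> n < r then 0
     else (if k = 0 then 0 else qr_stirling2 p r (n - 1) (k - 1))
          + pcompose p (q_bracket k) * qr_stirling2 p r (n - 1) k)"
  by pat_completeness auto
termination by (relation "measure (\<lambda>(p, r, n, k). n)") auto

function qr_stirling1 :: "int poly \<Rightarrow> nat \<Rightarrow> nat \<Rightarrow> nat \<Rightarrow> int poly" where
  "qr_stirling1 p r n k =
    (if n = r \<and> k = r then 1
     else if k < r \<or> k > n \<or> n < r then 0
     else (if k = 0 then 0 else qr_stirling1 p r (n - 1) (k - 1))
          - pcompose p (q_bracket (n - 1)) * qr_stirling1 p r (n - 1) k)"
  by pat_completeness auto
termination by (relation "measure (\<lambda>(p, r, n, k). n)") auto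

declare qr_stirling2.simps [simp del] qr_stirling1.simps [simp del]

end

theory Submission
  imports Defs "HOL-Computational_Algebra.Formal_Power_Series"
begin

text \<open>
  Write \<open>a j\<close> for \<open>p([j]\<^sub>q)\<close>. The identity is Newton's identity for the quantities
  \<open>a r, \<dots>, a n\<close>. Put \<open>E(X) = (1 - a r X) \<cdots> (1 - a n X)\<close>. The two recurrences say that
  \<open>E\<close> is the generating function of the Stirling numbers of the first kind in row \<open>n + 1\<close>,
  read from the diagonal to the left (\<open>fps_nth_prod_eq_qr_stirling1\<close>), and that \<open>1 / E\<close> is the
  generating function of those of the second kind in column \<open>n\<close>
  (\<open>qr_stirling2_column_inverse\<close>). Up to sign they are the elementary and the complete
  homogeneous symmetric polynomials in the \<open>a j\<close>.

  Logarithmic differentiation gives \<open>- X E' / E = (\<Sum>j. a j X / (1 - a j X))\<close>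
  (\<open>fps_deriv_prod_linear\<close>), and the coefficient of \<open>X\<^sup>k\<close> on the right is the power sum
  \<open>(\<Sum>j. a j ^ k)\<close>. On the left it is the convolution of \<open>- l e\<^sub>l\<close>, where \<open>e\<^sub>l\<close> is
  the coefficient of \<open>X\<^sup>l\<close> in \<open>E\<close>, with the coefficients of \<open>1 / E\<close>.
\<close>

lemma fps_nth_mult_linear:
  fixes f :: "'a::comm_ring_1 fps"
  shows "fps_nth (f * (1 - fps_const c * fps_X)) m =
    fps_nth f m - (if m = 0 then 0 else c * fps_nth f (m - 1))"
proof -
  have "f * (1 - fps_const c * fps_X) = f - fps_const c * (fps_X * f)"
    by (simp add: algebra_simps)
  then show ?thesis by simp
qed

lemma geometric_fps_mult_linear:
  "Abs_fps (\<lambda>m. c ^ m) * (1 - fps_const c * fps_X) = (1 :: 'a::comm_ring_1 fps)"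
proof (rule fps_ext)
  fix m
  show "fps_nth (Abs_fps (\<lambda>m. c ^ m) * (1 - fps_const c * fps_X)) m = fps_nth (1 :: 'a fps) m"
    by (cases m) (simp_all add: fps_nth_mult_linear)
qed

text \<open>The product rule, in the form of a logarithmic derivative: each factor \<open>1 - c X\<close>
  contributes \<open>- c / (1 - c X)\<close>, and that quotient is a geometric series.\<close>

lemma fps_deriv_prod_linear:
  fixes a :: "'b \<Rightarrow> 'a::comm_ring_1"
  assumes "finite A"
  shows "fps_deriv (\<Prod>j\<in>A. 1 - fps_const (a j) * fps_X) =
    - (\<Prod>j\<in>A. 1 - fps_const (a j) * fps_X) * (\<Sum>j\<in>A. fps_const (a j) * Abs_fps (\<lambda>m. a j ^ m))"
  using assms
proof (induction A rule: finite_induct)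
  case empty
  show ?case by simp
next
  case (insert x A)
  define L where "L = 1 - fps_const (a x) * fps_X"
  define E where "E = (\<Prod>j\<in>A. 1 - fps_const (a j) * fps_X)"
  define G where "G = Abs_fps (\<lambda>m. a x ^ m)"
  define T where "T = (\<Sum>j\<in>A. fps_const (a j) * Abs_fps (\<lambda>m. a j ^ m))"
  have GL: "G * L = 1"
    unfolding G_def L_def by (rule geometric_fps_mult_linear)
  have L': "fps_deriv L = - fps_const (a x)"
    by (simp add: L_def)
  have E': "fps_deriv E = - E * T"
    using insert.IH unfolding E_def T_def .
  have "fps_deriv (L * E) = - (L * E) * T - fps_const (a x) * E"
    by (simp add: L' E' algebra_simps flip: fps_const_neg)
  also have "\<dots> = - (L * E) * T - fps_const (a x) * E * (G * L)"
    by (simp add: GL)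
  also have "\<dots> = - (L * E) * (fps_const (a x) * G + T)"
    by (simp add: algebra_simps)
  finally show ?case
    using insert.hyps by (simp add: L_def E_def G_def T_def)
qed

lemma power_sum_eq_convolution:
  fixes a :: "'b \<Rightarrow> 'a::comm_ring_1"
  assumes "finite A" and "k \<ge> 1"
    and inverse: "H * (\<Prod>j\<in>A. 1 - fps_const (a j) * fps_X) = 1"
  shows "(\<Sum>j\<in>A. a j ^ k) =
    - (\<Sum>l = 1..k. of_nat l * fps_nth (\<Prod>j\<in>A. 1 - fps_const (a j) * fps_X) l * fps_nth H (k - l))"
proof -
  define E where "E = (\<Prod>j\<in>A. 1 - fps_const (a j) * fps_X)"
  define T where "T = (\<Sum>j\<in>A. fps_const (a j) * Abs_fps (\<lambda>m. a j ^ m))"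
  obtain k' where k: "k = Suc k'"
    using \<open>k \<ge> 1\<close> by (cases k) auto
  have "fps_deriv E * H = - (H * E) * T"
    using fps_deriv_prod_linear[OF \<open>finite A\<close>, of a] by (simp add: E_def T_def algebra_simps)
  then have T: "fps_deriv E * H = - T"
    using inverse by (simp add: E_def)
  have "(\<Sum>j\<in>A. a j ^ k) = fps_nth T k'"
    by (simp add: T_def fps_sum_nth k)
  also have "\<dots> = - fps_nth (fps_deriv E * H) k'"
    by (simp add: T)
  also have "fps_nth (fps_deriv E * H) k' =
      (\<Sum>l = 0..k'. of_nat (Suc l) * fps_nth E (Suc l) * fps_nth H (k - Suc l))"
    by (simp add: fps_mult_nth k)
  also have "\<dots> = (\<Sum>l = 1..k. of_nat l * fps_nth E l * fps_nth H (k - l))"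
    unfolding k One_nat_def by (rule sum.shift_bounds_cl_Suc_ivl[symmetric])
  finally show ?thesis
    unfolding E_def .
qed

lemma qr_stirling1_eq_0: "k < r \<or> k > n \<Longrightarrow> qr_stirling1 p r n k = 0"
  by (subst qr_stirling1.simps) auto

lemma qr_stirling2_eq_0: "k < r \<or> k > n \<Longrightarrow> qr_stirling2 p r n k = 0"
  by (subst qr_stirling2.simps) auto

lemma qr_stirling1_diag_base: "qr_stirling1 p r r r = 1"
  by (subst qr_stirling1.simps) simp

lemma qr_stirling2_diag_base: "qr_stirling2 p r r r = 1"
  by (subst qr_stirling2.simps) simp

text \<open>Outside the triangle \<open>r \<le> k \<le> n + 1\<close> both sides vanish, so the recurrences hold for
  every \<open>k\<close>.\<close>

lemma qr_stirling1_Suc: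
  assumes "n \<ge> r"
  shows "qr_stirling1 p r (Suc n) k = (if k = 0 then 0 else qr_stirling1 p r n (k - 1))
    - pcompose p (q_bracket n) * qr_stirling1 p r n k"
proof (cases "k < r \<or> k > Suc n")
  case True
  then have "k = 0 \<or> qr_stirling1 p r n (k - 1) = 0"
    by (cases k) (auto intro: qr_stirling1_eq_0)
  with True show ?thesis by (auto simp: qr_stirling1_eq_0)
next
  case False
  then show ?thesis using assms by (subst qr_stirling1.simps) auto
qed

lemma qr_stirling2_Suc:
  assumes "n \<ge> r"
  shows "qr_stirling2 p r (Suc n) k = (if k = 0 then 0 else qr_stirling2 p r n (k - 1))
    + pcompose p (q_bracket k) * qr_stirling2 p r n k"
proof (cases "k < r \<or> k > Suc n")
  case True
  then have "k = 0 \<or> qr_stirling2 p r n (k - 1) = 0"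
    by (cases k) (auto intro: qr_stirling2_eq_0)
  with True show ?thesis by (auto simp: qr_stirling2_eq_0)
next
  case False
  then show ?thesis using assms by (subst qr_stirling2.simps) auto
qed

text \<open>The vanishing beyond degree \<open>d\<close> is part of the claim: for \<open>r = 0\<close> and \<open>l = d + 1\<close> the
  truncated difference \<open>r + d - l\<close> is \<open>0\<close>, where the Stirling number need not vanish, so the
  induction needs this bound separately.\<close>

lemma fps_nth_prod_eq_qr_stirling1:
  "fps_nth (\<Prod>j = r..<r + d. 1 - fps_const (pcompose p (q_bracket j)) * fps_X) l =
    (if l \<le> d then qr_stirling1 p r (r + d) (r + d - l) else 0)"
proof (induction d arbitrary: l)
  case 0
  show ?case by (simp add: qr_stirling1_diag_base)
next
  case (Suc d)
  show ?case
  proof (cases l)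
    case 0
    then show ?thesis
      using Suc.IH by (simp add: fps_nth_mult_linear qr_stirling1_Suc qr_stirling1_eq_0)
  next
    case (Suc l')
    \<comment> \<open>At the end \<open>l' = d\<close> of the row the first summand of the recurrence is
       \<open>qr_stirling1 p r (r + d) (r - 1)\<close>, which lies outside the triangle.\<close>
    have "qr_stirling1 p r (r + d) (r - Suc 0) = 0" if "r > 0"
      using that by (intro qr_stirling1_eq_0) auto
    then show ?thesis
      using Suc Suc.IH
      by (auto simp: fps_nth_mult_linear qr_stirling1_Suc le_Suc_eq not_le Suc_diff_le)
  qed
qed

text \<open>By its recurrence, multiplying the generating function of column \<open>n\<close> by
  \<open>1 - a n X\<close> yields that of column \<open>n - 1\<close>; column \<open>r\<close> is a geometric series.\<close>

lemma qr_stirling2_column_inverse: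
  assumes "n \<ge> r"
  shows "Abs_fps (\<lambda>m. qr_stirling2 p r (n + m) n) *
    (\<Prod>j = r..n. 1 - fps_const (pcompose p (q_bracket j)) * fps_X) = 1"
  using assms
proof (induction n rule: dec_induct)
  case base
  have "qr_stirling2 p r (r + m) r = pcompose p (q_bracket r) ^ m" for m
    by (induction m) (auto simp: qr_stirling2_diag_base qr_stirling2_Suc qr_stirling2_eq_0)
  then show ?case
    by (simp add: geometric_fps_mult_linear)
next
  case (step n)
  define F where "F n = Abs_fps (\<lambda>m. qr_stirling2 p r (n + m) n)" for n
  define L where "L j = 1 - fps_const (pcompose p (q_bracket j)) * fps_X" for j
  have column: "F (Suc n) * L (Suc n) = F n"
  proof (rule fps_ext)
    fix m
    show "fps_nth (F (Suc n) * L (Suc n)) m = fps_nth (F n) m"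
      using \<open>r \<le> n\<close>
      by (cases m) (simp_all add: F_def L_def fps_nth_mult_linear qr_stirling2_Suc qr_stirling2_eq_0)
  qed
  have "F (Suc n) * (\<Prod>j = r..Suc n. L j) = F (Suc n) * L (Suc n) * (\<Prod>j = r..n. L j)"
    using \<open>r \<le> n\<close> by (simp add: prod.nat_ivl_Suc' mult.assoc)
  also have "\<dots> = 1"
    using step.IH by (simp add: column) (simp add: F_def L_def)
  finally show ?case
    by (simp add: F_def L_def)
qed

theorem theorem7p4:
  fixes p :: "int poly" and r n k :: nat
  assumes "n \<ge> r" and "k \<ge> 1"
  shows "(\<Sum>j = r..n. (pcompose p (q_bracket j)) ^ k) =
    - (\<Sum>l = 1..n - r + 1.
         of_nat l * qr_stirling1 p r (n + 1) (n + 1 - l) * qr_stirling2 p r (n + k - l) n)"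
proof -
  define E where "E = (\<Prod>j = r..n. 1 - fps_const (pcompose p (q_bracket j)) * fps_X)"
  define H where "H = Abs_fps (\<lambda>m. qr_stirling2 p r (n + m) n)"
  have E_nth: "fps_nth E l = (if l \<le> n - r + 1 then qr_stirling1 p r (n + 1) (n + 1 - l) else 0)" for l
    using fps_nth_prod_eq_qr_stirling1[of p r "n - r + 1" l] \<open>n \<ge> r\<close>
    by (simp add: E_def atLeastLessThanSuc_atLeastAtMost)
  have "(\<Sum>j = r..n. (pcompose p (q_bracket j)) ^ k) =
      - (\<Sum>l = 1..k. of_nat l * fps_nth E l * fps_nth H (k - l))"
    unfolding E_def H_def
    using \<open>k \<ge> 1\<close> qr_stirling2_column_inverse[OF \<open>n \<ge> r\<close>]
    by (intro power_sum_eq_convolution) simp_all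
  \<comment> \<open>The two ranges of summation differ only by zero terms: \<open>E\<close> has degree at most
     \<open>n - r + 1\<close>, and for \<open>l > k\<close> the row index \<open>n + k - l\<close> is below the column index \<open>n\<close>.
     As \<open>l \<le> n + 1\<close> and \<open>k \<ge> 1\<close>, that row index is not truncated.\<close>
  also have "(\<Sum>l = 1..k. of_nat l * fps_nth E l * fps_nth H (k - l)) =
      (\<Sum>l \<in> {1..k} \<inter> {1..n - r + 1}. of_nat l * fps_nth E l * fps_nth H (k - l))"
    by (rule sum.mono_neutral_right) (auto simp: E_nth)
  also have "\<dots> = (\<Sum>l = 1..n - r + 1.
      of_nat l * qr_stirling1 p r (n + 1) (n + 1 - l) * qr_stirling2 p r (n + k - l) n)"
    using \<open>n \<ge> r\<close> \<open>k \<ge> 1\<close>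
    by (intro sum.mono_neutral_cong_left) (auto simp: E_nth H_def qr_stirling2_eq_0)
  finally show ?thesis .
qed

end
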